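(* Let $n \ge 3$ and let $M \in \mathcal{T}_n$ be a tournament matrix of order $n$. If $M \in \mathcal{T}_n \setminus \mathcal{S}_n$ (that is, $M$ is nonsingular), then $$C_3(M) \ge n - 2\left\lfloor \frac{n}{3} \right\rfloor.$$ Furthermore, $M \in \mathcal{T}_n \setminus \mathcal{S}_n$ and $C_3(M) = n - 2\left\lfloor \frac{n}{3} \right\rfloor$ if and only if the strongly connected components of $M$ are all upset tournaments and the number of strongly connected components of $M$ is exactly $\left\lfloor \frac{n}{3} \right\rfloor$.
   Context: A tournament of order $n$ is a digraph obtained by orienting each edge of the complete graph on $n$ vertices; a tournament matrix of order $n$ is its adjacency matrix, i.e. an $n \times n$ $(0,1)$-matrix $M$ with $M + M^T = J_n - I_n$, where $J_n$ is the all-ones matrix and $I_n$ the identity ($m_{ij}=1$ iff there is an arc from vertex $i$ to vertex $j$). Tournaments and tournament matrices are identified: graph properties of a tournament are attributed to its matrix and vice versa. $\mathcal{T}_n$ denotes the set of tournament matrices of order $n$, and $\mathcal{S}_n \subseteq \mathcal{T}_n$ the set of singular ones (singularity over the real/complex numbers). $C_3(M)$ is the number of directed $3$-cycles in the tournament $M$, counted as $3$-vertex subsets inducing a directed cycle. The strongly connected components of $M$ are the subtournaments induced on the equivalence classes of vertices under the relation "there is a directed walk from $u$ to $v$ and a directed walk from $v$ to $u$". A transitive tournament is one in which $u \to v$ and $v \to w$ imply $u \to w$. An upset tournament of order $m \ge 3$ is a tournament obtained from a transitive tournament of order $m$ by choosing a directed path from the vertex of outdegree $m-1$ to the vertex of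 outdegree $0$ and reversing all arcs on that path. *)

theory Defs
  imports "Jordan_Normal_Form.Determinant"
begin

definition all_ones_mat :: "nat \<Rightarrow> real mat" where
  "all_ones_mat n = mat n n (\<lambda>_. 1)"

definition tournament_mats :: "nat \<Rightarrow> real mat set" where
  "tournament_mats n =
     {M \<in> carrier_mat n n. elements_mat M \<subseteq> {0, 1} \<and>
        M + transpose_mat M = all_ones_mat n - 1\<^sub>m n}"

definition singular_tournament_mats :: "nat \<Rightarrow> real mat set" where
  "singular_tournament_mats n = {M \<in> tournament_mats n. \<not> invertible_mat M}"

text \<open>A digraph is a pair of a vertex set and an arc relation; \<^term>\<open>(u, v)\<close> is the
  arc from \<^term>\<open>u\<close> to \<^term>\<open>v\<close>.\<close>

type_synonym 'a digraph = "'a set \<times> 'a rel"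

definition mat_verts :: "real mat \<Rightarrow> nat set" where
  "mat_verts M = {0..<dim_row M}"

definition mat_arcs :: "real mat \<Rightarrow> nat rel" where
  "mat_arcs M = {(i, j). i \<in> mat_verts M \<and> j \<in> mat_verts M \<and> M $$ (i, j) = 1}"

definition num_3cycles :: "real mat \<Rightarrow> nat" where
  "num_3cycles M =
     card {S. S \<subseteq> mat_verts M \<and> card S = 3 \<and>
       (\<exists>u v w. S = {u, v, w} \<and>
          (u, v) \<in> mat_arcs M \<and> (v, w) \<in> mat_arcs M \<and> (w, u) \<in> mat_arcs M)}"

definition mutually_reachable :: "real mat \<Rightarrow> nat rel" where
  "mutually_reachable M =
     {(u, v). u \<in> mat_verts M \<and> v \<in> mat_verts M \<and>
        (u, v) \<in> (mat_arcs M)\<^sup>* \<and> (v, u) \<in> (mat_arcs M)\<^sup>*}"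

definition strong_components :: "real mat \<Rightarrow> nat digraph set" where
  "strong_components M =
     (\<lambda>C. (C, mat_arcs M \<inter> C \<times> C)) ` (mat_verts M // mutually_reachable M)"

definition tournament :: "'a digraph \<Rightarrow> bool" where
  "tournament = (\<lambda>(V, A). finite V \<and> A \<subseteq> V \<times> V \<and> asym A \<and> total_on V A)"

definition transitive_tournament :: "'a digraph \<Rightarrow> bool" where
  "transitive_tournament T \<longleftrightarrow> tournament T \<and> trans (snd T)"

definition outdegree :: "'a digraph \<Rightarrow> 'a \<Rightarrow> nat" where
  "outdegree T v = card (snd T `` {v})"

definition path_arcs :: "'a list \<Rightarrow> 'a rel" where
  "path_arcs p = set (zip p (tl p))"

definition directed_path :: "'a digraph \<Rightarrow> 'a list \<Rightarrow> bool" where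
  "directed_path T p \<longleftrightarrow>
     p \<noteq> [] \<and> distinct p \<and> set p \<subseteq> fst T \<and> path_arcs p \<subseteq> snd T"

definition reverse_arcs :: "'a rel \<Rightarrow> 'a digraph \<Rightarrow> 'a digraph" where
  "reverse_arcs B = (\<lambda>(V, A). (V, (A - B) \<union> B\<inverse>))"

definition upset_tournament :: "'a digraph \<Rightarrow> bool" where
  "upset_tournament H \<longleftrightarrow>
     card (fst H) \<ge> 3 \<and>
     (\<exists>T p. transitive_tournament T \<and> directed_path T p \<and>
        outdegree T (hd p) = card (fst T) - 1 \<and> outdegree T (last p) = 0 \<and>
        H = reverse_arcs (path_arcs p) T)"

end

theory Submission
  imports Defs
begin

text \<open>
  Order the vertices of a strong tournament of order m by outdegree. Every proper initial segment
  of this order sends at least one arc to its complement, so the partial sums of the scores exceed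
  those of the transitive tournament by at least 1. Since the number of 3-cycles is
  C(m, 3) minus the sum of C(d, 2) over the scores d, summation by parts gives at least m - 2
  3-cycles, with equality iff every cut is crossed by exactly one upward arc. These crossing arcs
  then tile the order into a path, which is precisely the description of an upset tournament.

  In general the 3-cycles of M are those of its strong components. A component with one
  vertex makes M singular, and there is none with two vertices, so in a nonsingular M with k
  components there are at least n - 2 k 3-cycles and 3 k \<le> n. Conversely, if there are exactly
  \<lfloor>n / 3\<rfloor> components, all upset, their orders are between 3 and 5, where upset tournaments are
  nonsingular (some of order 6 are singular).
\<close>

section \<open>3-cycles and scores\<close>

text \<open>The set counted by \<open>num_3cycles\<close>, with vertex set and arc relation as
  separate arguments so that it applies to strong components as well as to the whole matrix.\<close>

definition cyclic_triples :: "'a set \<Rightarrow> 'a rel \<Rightarrow> 'a set set" where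
  "cyclic_triples V A = {S. S \<subseteq> V \<and> card S = 3 \<and>
     (\<exists>u v w. S = {u, v, w} \<and> (u, v) \<in> A \<and> (v, w) \<in> A \<and> (w, u) \<in> A)}"

lemma tournamentD:
  assumes "tournament (V, A)"
  shows "finite V" "A \<subseteq> V \<times> V" "asym A" "total_on V A" "finite A"
    "\<And>u v. (u, v) \<in> A \<Longrightarrow> (v, u) \<notin> A" "\<And>u. (u, u) \<notin> A"
    "\<And>u v. u \<in> V \<Longrightarrow> v \<in> V \<Longrightarrow> u \<noteq> v \<Longrightarrow> (u, v) \<in> A \<or> (v, u) \<in> A"
  using assms unfolding tournament_def total_on_def
  by (auto dest: asymD intro: finite_subset[of A "V \<times> V"])

lemma tournament_induced:
  assumes "tournament (V, A)" "S \<subseteq> V"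
  shows "tournament (S, A \<inter> S \<times> S)"
proof -
  note T = tournamentD[OF assms(1)]
  have "total_on S (A \<inter> S \<times> S)"
    using T(8) assms(2) by (intro total_onI) blast
  then show ?thesis
    using T(1,6) assms(2) unfolding tournament_def asym_iff by (auto intro: finite_subset)
qed

lemma card_tournament_arcs:
  assumes "tournament (V, A)"
  shows "card A = card V choose 2"
proof -
  note T = tournamentD[OF assms]
  have "bij_betw (\<lambda>(u, v). {u, v}) A {S. S \<subseteq> V \<and> card S = 2}"
    unfolding bij_betw_def
  proof
    show "inj_on (\<lambda>(u, v). {u, v}) A"
      using T(6) by (fastforce simp: inj_on_def doubleton_eq_iff)
    show "(\<lambda>(u, v). {u, v}) ` A = {S. S \<subseteq> V \<and> card S = 2}"
    proof (intro equalityI subsetI)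
      fix S assume "S \<in> (\<lambda>(u, v). {u, v}) ` A"
      then obtain u v where "S = {u, v}" "(u, v) \<in> A" by auto
      moreover from this have "u \<noteq> v" using T(7) by auto
      ultimately show "S \<in> {S. S \<subseteq> V \<and> card S = 2}"
        using T(2) by auto
    next
      fix S assume "S \<in> {S. S \<subseteq> V \<and> card S = 2}"
      then obtain u v where "S = {u, v}" "u \<noteq> v" "u \<in> V" "v \<in> V"
        by (auto simp: card_2_iff)
      then show "S \<in> (\<lambda>(u, v). {u, v}) ` A"
        using T(8)[of u v]
        by (auto simp: insert_commute image_iff intro: bexI[of _ "(u, v)"] bexI[of _ "(v, u)"])
    qed
  qed
  then show ?thesis
    using n_subsets[OF T(1), of 2] bij_betw_same_card by fastforce
qed

text \<open>Every arc leaving a vertex of \<open>S\<close> ends inside \<open>S\<close> or outside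
  it, and those inside are the arcs of the induced tournament. For a fixed size of \<open>S\<close>,
  the sum of scores thus measures the arcs crossing the cut.\<close>

lemma sum_outdegree:
  assumes "tournament (V, A)" "S \<subseteq> V"
  shows "(\<Sum>v\<in>S. outdegree (V, A) v) = (card S choose 2) + card (A \<inter> S \<times> (V - S))"
proof -
  note T = tournamentD[OF assms(1)]
  have fS: "finite S" using assms(2) T(1) finite_subset by blast
  have "(\<Sum>v\<in>S. outdegree (V, A) v) = card (SIGMA v:S. A `` {v})"
    using fS T(5) by (simp add: outdegree_def finite_Image)
  also have "(SIGMA v:S. A `` {v}) = (A \<inter> S \<times> S) \<union> (A \<inter> S \<times> (V - S))"
    using T(2) by auto
  also have "card \<dots> = card (A \<inter> S \<times> S) + card (A \<inter> S \<times> (V - S))"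
    using T(5) by (intro card_Un_disjoint) auto
  finally show ?thesis
    using card_tournament_arcs[OF tournament_induced[OF assms]] by simp
qed

text \<open>A triple that is not cyclic is transitive and has exactly one vertex dominating the
  other two. The sets \<open>D v\<close> sort the transitive triples by this vertex, and each is
  given by a pair of out-neighbours of \<open>v\<close>.\<close>

lemma card_cyclic_triples:
  assumes "tournament (V, A)"
  shows "card (cyclic_triples V A) + (\<Sum>v\<in>V. outdegree (V, A) v choose 2) = card V choose 3"
proof -
  note T = tournamentD[OF assms]
  define D where "D v = insert v ` {P. P \<subseteq> A `` {v} \<and> card P = 2}" for v
  have D_iff: "S \<in> D v \<longleftrightarrow> (\<exists>a b. S = {v, a, b} \<and> a \<noteq> b \<and> (v, a) \<in> A \<and> (v, b) \<in> A)"
    (is "?l \<longleftrightarrow> ?r") for S v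
  proof
    assume ?l
    then show ?r unfolding D_def card_2_iff by blast
  next
    assume ?r
    then obtain a b where "S = insert v {a, b}" "a \<noteq> b" "(v, a) \<in> A" "(v, b) \<in> A" by blast
    then show ?l unfolding D_def by (intro image_eqI[of _ _ "{a, b}"]) auto
  qed
  have outA: "A `` {v} \<subseteq> V" "v \<notin> A `` {v}" "finite (A `` {v})" for v
    using T(2,5,7) by (auto simp: finite_Image)
  have card_D: "card (D v) = outdegree (V, A) v choose 2" for v
  proof -
    have "inj_on (insert v) {P. P \<subseteq> A `` {v} \<and> card P = 2}"
      using outA(2)[of v] by (intro inj_onI) (metis (mono_tags, lifting) insert_ident mem_Collect_eq subsetD)
    then show ?thesis
      using n_subsets[OF outA(3), of v 2] by (simp add: D_def card_image outdegree_def)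
  qed
  have fin: "finite {S. S \<subseteq> V \<and> card S = 3}"
    using T(1) by simp
  have Dsub: "D v \<subseteq> {S. S \<subseteq> V \<and> card S = 3}" if "v \<in> V" for v
  proof
    fix S assume "S \<in> D v"
    then obtain a b where *: "S = {v, a, b}" "a \<noteq> b" "(v, a) \<in> A" "(v, b) \<in> A"
      unfolding D_iff by blast
    then have "v \<noteq> a" "v \<noteq> b" using T(7) by auto
    with * show "S \<in> {S. S \<subseteq> V \<and> card S = 3}" using T(2) by auto
  qed
  have disj: "D v \<inter> D w = {}" if "v \<noteq> w" for v w
  proof -
    have False if "S \<in> D v" "S \<in> D w" for S
    proof -
      have "w \<in> S" "v \<in> S" using that unfolding D_iff by auto
      then have "(v, w) \<in> A" "(w, v) \<in> A" using that \<open>v \<noteq> w\<close> unfolding D_iff by auto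
      then show False using T(6) by blast
    qed
    then show ?thesis by blast
  qed
  have disj2: "cyclic_triples V A \<inter> (\<Union>v\<in>V. D v) = {}"
  proof -
    have False if SC: "S \<in> cyclic_triples V A" and SD: "S \<in> D v" for S v
    proof -
      obtain x y z where S: "S = {x, y, z}" "(x, y) \<in> A" "(y, z) \<in> A" "(z, x) \<in> A"
        using SC unfolding cyclic_triples_def by blast
      have "v \<in> S" "\<And>w. w \<in> S \<Longrightarrow> w \<noteq> v \<Longrightarrow> (v, w) \<in> A"
        using SD unfolding D_iff by auto
      moreover from calculation(1) S(1) have "v = x \<or> v = y \<or> v = z" by auto
      ultimately show False using S T(6,7) by (metis insertI1 insertI2)
    qed
    then show ?thesis by blast
  qed
  have cover: "{S. S \<subseteq> V \<and> card S = 3} = cyclic_triples V A \<union> (\<Union>v\<in>V. D v)"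
  proof (intro equalityI subsetI)
    fix S assume "S \<in> {S. S \<subseteq> V \<and> card S = 3}"
    then obtain x y z where S: "S = {x, y, z}" "x \<noteq> y" "y \<noteq> z" "x \<noteq> z"
      and V: "x \<in> V" "y \<in> V" "z \<in> V" and c: "card S = 3"
      by (auto simp: card_3_iff)
    have perm: "{x, y, z} = {y, x, z}" "{x, y, z} = {z, x, y}" "{x, z, y} = {x, y, z}" by auto
    have cyc: "S \<in> cyclic_triples V A" if "(x, y) \<in> A \<and> (y, z) \<in> A \<and> (z, x) \<in> A \<or>
        (x, z) \<in> A \<and> (z, y) \<in> A \<and> (y, x) \<in> A"
    proof -
      have "\<exists>u v w. S = {u, v, w} \<and> (u, v) \<in> A \<and> (v, w) \<in> A \<and> (w, u) \<in> A"
        using that unfolding S(1) using perm(3) by metis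
      then show ?thesis using S(1) V c unfolding cyclic_triples_def by simp
    qed
    have dom: "S \<in> D x" if "(x, y) \<in> A" "(x, z) \<in> A" unfolding D_iff using that S by blast
    have dom2: "S \<in> D y" if "(y, x) \<in> A" "(y, z) \<in> A" unfolding D_iff using that S perm by metis
    have dom3: "S \<in> D z" if "(z, x) \<in> A" "(z, y) \<in> A" unfolding D_iff using that S perm by metis
    show "S \<in> cyclic_triples V A \<union> (\<Union>v\<in>V. D v)"
      using T(8)[of x y] T(8)[of y z] T(8)[of x z] V S(2-4) cyc dom dom2 dom3 by auto
  next
    fix S assume "S \<in> cyclic_triples V A \<union> (\<Union>v\<in>V. D v)"
    then show "S \<in> {S. S \<subseteq> V \<and> card S = 3}"
      using Dsub unfolding cyclic_triples_def by blast
  qed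
  have "card V choose 3 = card (cyclic_triples V A \<union> (\<Union>v\<in>V. D v))"
    using n_subsets[OF T(1), of 3] cover by simp
  also have "\<dots> = card (cyclic_triples V A) + card (\<Union>v\<in>V. D v)"
  proof (rule card_Un_disjoint[OF _ _ disj2])
    show "finite (cyclic_triples V A)" "finite (\<Union>v\<in>V. D v)"
      using fin unfolding cover by simp_all
  qed
  also have "card (\<Union>v\<in>V. D v) = (\<Sum>v\<in>V. card (D v))"
    using T(1) disj finite_subset[OF Dsub fin] by (intro card_UN_disjoint) auto
  finally show ?thesis by (simp add: card_D)
qed

section \<open>Sums of squares of the extremal score sequence\<close>

lemma sum_by_parts:
  fixes f s :: "nat \<Rightarrow> 'a::comm_ring_1"
  shows "(\<Sum>i<Suc n. (f i - f (Suc i)) * s i) =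
    f 0 * s 0 - f (Suc n) * s n + (\<Sum>i<n. f (Suc i) * (s (Suc i) - s i))"
  by (induction n) (simp_all add: algebra_simps)

text \<open>For m \<ge> 3 this is the sequence 1, 1, 2, 3, ..., m - 3, m - 2, m - 2.\<close>

definition upset_score :: "nat \<Rightarrow> nat \<Rightarrow> int" where
  "upset_score m i = int i + (if i = 0 then 1 else 0) - (if Suc i = m then 1 else 0)"

lemma two_choose_two: "2 * int (n choose 2) = (int n)\<^sup>2 - int n"
  by (induction n) (simp_all add: numeral_2_eq_2 power2_eq_square algebra_simps)

text \<open>Summing i^2 = 2 C(i, 2) + i by the hockey-stick identity gives this form, which matches
  the binomials of the 3-cycle count.\<close>

lemma sum_squares_choose:
  "(\<Sum>i<m. (int i)\<^sup>2) = 2 * int (m choose 3) + int (m choose 2)"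
proof (induction m)
  case (Suc m)
  with two_choose_two[of m] show ?case
    by (simp add: numeral_2_eq_2 numeral_3_eq_3 power2_eq_square algebra_simps)
qed (simp add: numeral_2_eq_2 numeral_3_eq_3)

text \<open>The sequence differs from 0, ..., m - 1 only at its ends: 0 becomes 1 and m - 1 becomes
  m - 2. The sum of squares changes by 1 - (2 m - 3) = -2 (m - 2).\<close>

lemma sum_upset_score_squares:
  assumes "m \<ge> 3"
  shows "(\<Sum>i<m. (upset_score m i)\<^sup>2) + 2 * (int m - 2) = 2 * int (m choose 3) + int (m choose 2)"
proof -
  from assms obtain r where m: "m = Suc (Suc (Suc r))"
    by (metis add_Suc add_0 le_Suc_ex numeral_3_eq_3)
  have mid: "upset_score m (Suc i) = int (Suc i)" if "i < Suc r" for i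
    using that unfolding upset_score_def m by auto
  have "(\<Sum>i<m. (upset_score m i)\<^sup>2) =
      (upset_score m 0)\<^sup>2 + (\<Sum>i<Suc r. (upset_score m (Suc i))\<^sup>2) + (upset_score m (Suc (Suc r)))\<^sup>2"
    unfolding m sum.lessThan_Suc_shift[of _ "Suc (Suc r)"] by simp
  also have "(\<Sum>i<Suc r. (upset_score m (Suc i))\<^sup>2) = (\<Sum>i<Suc r. (int (Suc i))\<^sup>2)"
    using mid by (intro sum.cong) auto
  also have "(upset_score m 0)\<^sup>2 = 1" unfolding upset_score_def m by simp
  also have "(upset_score m (Suc (Suc r)))\<^sup>2 = (int r + 1)\<^sup>2"
    unfolding upset_score_def m by (simp add: algebra_simps)
  finally have 1: "(\<Sum>i<m. (upset_score m i)\<^sup>2) = 1 + (\<Sum>i<Suc r. (int (Suc i))\<^sup>2) + (int r + 1)\<^sup>2" .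
  have "(\<Sum>i<m. (int i)\<^sup>2) = (\<Sum>i<Suc r. (int (Suc i))\<^sup>2) + (int r + 2)\<^sup>2"
    unfolding m sum.lessThan_Suc_shift[of _ "Suc (Suc r)"] by (simp add: algebra_simps)
  with 1 sum_squares_choose[of m] show ?thesis
    unfolding m by (simp add: power2_eq_square algebra_simps)
qed

section \<open>Extremality among score sequences with slack at every cut\<close>

context
  fixes d :: "nat \<Rightarrow> int" and m :: nat
  assumes m3: "m \<ge> 3"
    and mono: "\<And>i. Suc i < m \<Longrightarrow> d i \<le> d (Suc i)"
    and total: "(\<Sum>i<m. d i) = int (m choose 2)"
    and partial: "\<And>k. 0 < k \<Longrightarrow> k < m \<Longrightarrow> (\<Sum>i<k. d i) > int (k choose 2)"
begin

text \<open>The k-th partial sum of \<open>d\<close> minus that of \<open>upset_score m\<close>: for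
  k \<le> m the latter is C(k, 2), plus 1 when 0 < k < m.\<close>

definition excess :: "nat \<Rightarrow> int" where
  "excess k = (\<Sum>i<k. d i) - int (k choose 2) - (if 0 < k \<and> k < m then 1 else 0)"

lemma excess_nonneg: "k \<le> m \<Longrightarrow> excess k \<ge> 0"
  using partial[of k] total unfolding excess_def by (cases "k = 0"; cases "k = m") auto

lemma excess_0 [simp]: "excess 0 = 0" and excess_m [simp]: "excess m = 0"
  using total unfolding excess_def by auto

lemma score_diff: "i < m \<Longrightarrow> upset_score m i - d i = excess i - excess (Suc i)"
  using m3 unfolding excess_def upset_score_def by (auto simp: numeral_2_eq_2)

lemma upset_score_mono: "Suc i < m \<Longrightarrow> upset_score m i \<le> upset_score m (Suc i)"
  using m3
  unfolding upset_score_def by auto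

lemma upset_score_strict: "0 < i \<Longrightarrow> Suc (Suc i) < m \<Longrightarrow> upset_score m i < upset_score m (Suc i)"
  unfolding upset_score_def by auto

text \<open>Factor a^2 - b^2 = (a - b)(a + b), write a - b as a difference of consecutive values of
  \<open>excess\<close>, and sum by parts; the boundary terms vanish. Each remaining summand is a
  product of nonnegative factors, since both sequences are nondecreasing.\<close>

lemma score_squares_diff:
  "(\<Sum>i<m. (upset_score m i)\<^sup>2) - (\<Sum>i<m. (d i)\<^sup>2) =
   (\<Sum>i<m - 1. excess (Suc i) *
      ((upset_score m (Suc i) - upset_score m i) + (d (Suc i) - d i)))"
proof -
  have S: "m = Suc (m - 1)" using m3 by simp
  have "(\<Sum>i<m. (upset_score m i)\<^sup>2) - (\<Sum>i<m. (d i)\<^sup>2) =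
      (\<Sum>i<m. (excess i - excess (Suc i)) * (upset_score m i + d i))"
    unfolding sum_subtractf[symmetric]
    by (intro sum.cong) (auto simp: score_diff[symmetric] power2_eq_square algebra_simps)
  also have "\<dots> = excess 0 * (upset_score m 0 + d 0) - excess m * (upset_score m (m - 1) + d (m - 1)) +
      (\<Sum>i<m - 1. excess (Suc i) * ((upset_score m (Suc i) + d (Suc i)) - (upset_score m i + d i)))"
    using sum_by_parts[of excess "\<lambda>i. upset_score m i + d i" "m - 1"] S by simp
  finally show ?thesis by (simp add: algebra_simps)
qed

lemma score_term_nonneg:
  assumes "i < m - 1"
  shows "excess (Suc i) * ((upset_score m (Suc i) - upset_score m i) + (d (Suc i) - d i)) \<ge> 0"
  using assms excess_nonneg[of "Suc i"] upset_score_mono[of i] mono[of i] by simp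

lemma score_squares_le: "(\<Sum>i<m. (d i)\<^sup>2) \<le> (\<Sum>i<m. (upset_score m i)\<^sup>2)"
proof -
  have "0 \<le> (\<Sum>i<m - 1. excess (Suc i) *
      ((upset_score m (Suc i) - upset_score m i) + (d (Suc i) - d i)))"
    using score_term_nonneg by (intro sum_nonneg) auto
  then show ?thesis using score_squares_diff by linarith
qed

text \<open>All summands of \<open>score_squares_diff\<close> must vanish. This kills
  \<open>excess\<close> wherever \<open>upset_score m\<close> increases strictly; at its two flat
  ends a linear relation between neighbouring values of \<open>excess\<close> finishes the
  argument.\<close>

lemma score_squares_eq_imp:
  assumes "(\<Sum>i<m. (d i)\<^sup>2) = (\<Sum>i<m. (upset_score m i)\<^sup>2)" "0 < k" "k < m"
  shows "(\<Sum>i<k. d i) = int (k choose 2) + 1"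
proof -
  have flat: "excess (Suc i) = 0 \<or> upset_score m (Suc i) = upset_score m i \<and> d (Suc i) = d i"
    if "Suc i < m" for i
  proof -
    have "excess (Suc i) * ((upset_score m (Suc i) - upset_score m i) + (d (Suc i) - d i)) = 0"
      using assms(1) score_squares_diff score_term_nonneg that
        sum_nonneg_eq_0_iff[of "{..<m - 1}" "\<lambda>i. excess (Suc i) *
          ((upset_score m (Suc i) - upset_score m i) + (d (Suc i) - d i))"] by auto
    then show ?thesis using mono[OF that] upset_score_mono[OF that] by auto
  qed
  \<comment> \<open>Here \<open>upset_score m\<close> increases strictly, which excludes the second
    alternative of \<open>flat\<close>.\<close>
  have middle: "excess (Suc i) = 0" if "0 < i" "Suc (Suc i) < m" for i
    using flat[of i] upset_score_strict[of i] that by auto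
  \<comment> \<open>If \<open>d\<close> and \<open>upset_score m\<close> are both constant on the
    first two indices, their difference is too, so \<open>excess\<close> changes by the same amount
    twice, starting from \<open>excess 0 = 0\<close>. The upper end is symmetric, with
    \<open>excess m = 0\<close>.\<close>
  have low: "excess 1 = 0 \<or> excess 2 = 2 * excess 1"
    using flat[of 0] score_diff[of 0] score_diff[of 1] m3 by (auto simp: numeral_2_eq_2)
  have high: "excess (m - 1) = 0 \<or> excess (m - 2) = 2 * excess (m - 1)"
  proof -
    obtain r where m: "m = Suc (Suc (Suc r))"
      using m3 by (metis add_Suc add_0 le_Suc_ex numeral_3_eq_3)
    show ?thesis
      using flat[of "Suc r"] score_diff[of "Suc r"] score_diff[of "Suc (Suc r)"] excess_m
      unfolding m by auto
  qed
  have "excess k = 0"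
  \<comment> \<open>For m = 3 there is no strictly increasing step, and the two end relations alone
    force both values to vanish. For larger m the values at 2 and m - 2 vanish first.\<close>
  proof (cases "m = 3")
    case True
    with low high assms(2,3) show ?thesis by (cases "k = 1") (auto simp: eval_nat_numeral less_Suc_eq)
  next
    case False
    with m3 have m4: "m \<ge> 4" by simp
    have "excess 2 = 0" "excess (m - 2) = 0"
      using middle[of 1] middle[of "m - 3"] m4
      by (auto simp: numeral_2_eq_2 Suc_diff_Suc numeral_3_eq_3)
    then have "excess 1 = 0" "excess (m - 1) = 0" using low high by auto
    then show ?thesis
      using middle[of "k - 1"] assms(2,3)
      by (cases "k = 1"; cases "k = m - 1") auto
  qed
  then show ?thesis using assms(2,3) unfolding excess_def by simp
qed

end

section \<open>3-cycles of strong tournaments and tight orderings\<close>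

text \<open>Links equality in the 3-cycle bound to upset tournaments: strong connectivity puts at
  least one arc across each of these cuts, and when each has exactly one, these arcs turn out to be
  the reversed path.\<close>

definition tight_ordering :: "'a set \<Rightarrow> 'a rel \<Rightarrow> (nat \<Rightarrow> 'a) \<Rightarrow> bool" where
  "tight_ordering V A p \<longleftrightarrow> bij_betw p {..<card V} V \<and>
     (\<forall>k. 0 < k \<and> k < card V \<longrightarrow> card (A \<inter> p ` {..<k} \<times> (V - p ` {..<k})) = 1)"

lemma sum_outdegree_prefix:
  assumes "tournament (V, A)" "bij_betw p {..<card V} V" "k \<le> card V"
  shows "(\<Sum>i<k. outdegree (V, A) (p i)) =
    (k choose 2) + card (A \<inter> p ` {..<k} \<times> (V - p ` {..<k}))"
proof -
  have inj: "inj_on p {..<k}"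
    using assms(2,3) by (auto simp: bij_betw_def intro: inj_on_subset)
  have sub: "p ` {..<k} \<subseteq> V"
    using assms(2,3) by (auto simp: bij_betw_def)
  show ?thesis
    using sum_outdegree[OF assms(1) sub] inj by (simp add: sum.reindex card_image)
qed

lemma sum_outdegree_total:
  assumes "tournament (V, A)"
  shows "(\<Sum>v\<in>V. outdegree (V, A) v) = card V choose 2"
  using sum_outdegree[OF assms subset_refl] by simp

text \<open>The surplus of 3-cycles over m - 2 is half the gap between the two sums of squares.
  Doubling, integers and additions avoid division and truncated subtraction.\<close>

lemma cyclic_triples_score:
  assumes "tournament (V, A)" "bij_betw p {..<card V} V" "card V \<ge> 3"
  shows "2 * int (card (cyclic_triples V A)) + (\<Sum>i<card V. (int (outdegree (V, A) (p i)))\<^sup>2) =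
    (\<Sum>i<card V. (upset_score (card V) i)\<^sup>2) + 2 * (int (card V) - 2)"
proof -
  let ?d = "outdegree (V, A)"
  have "2 * int (\<Sum>v\<in>V. ?d v choose 2) = (\<Sum>v\<in>V. (int (?d v))\<^sup>2) - int (\<Sum>v\<in>V. ?d v)"
    by (simp add: sum_distrib_left two_choose_two sum_subtractf)
  moreover have "(\<Sum>v\<in>V. (int (?d v))\<^sup>2) = (\<Sum>i<card V. (int (?d (p i)))\<^sup>2)"
    using sum.reindex_bij_betw[OF assms(2), of "\<lambda>v. (int (?d v))\<^sup>2"] by simp
  moreover have "int (card (cyclic_triples V A)) + int (\<Sum>v\<in>V. ?d v choose 2) = int (card V choose 3)"
    using card_cyclic_triples[OF assms(1)] by linarith
  ultimately show ?thesis
    using sum_outdegree_total[OF assms(1)] sum_upset_score_squares[OF assms(3)] by linarith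
qed

text \<open>One arc across each cut fixes all partial sums of the scores along \<open>p\<close>;
  their consecutive differences are exactly \<open>upset_score\<close>, so the gap between the sums
  of squares is zero.\<close>

lemma card_cyclic_triples_tight:
  assumes T: "tournament (V, A)" and p: "tight_ordering V A p" and m: "card V \<ge> 3"
  shows "card (cyclic_triples V A) = card V - 2"
proof -
  let ?d = "\<lambda>i. outdegree (V, A) (p i)" and ?m = "card V"
  have b: "bij_betw p {..<?m} V" using p by (simp add: tight_ordering_def)
  have pre: "(\<Sum>i<k. ?d i) = (k choose 2) + (if 0 < k \<and> k < ?m then 1 else 0)" if "k \<le> ?m" for k
  proof -
    have "p ` {..<?m} = V" using b by (simp add: bij_betw_def)
    then have "card (A \<inter> p ` {..<k} \<times> (V - p ` {..<k})) = (if 0 < k \<and> k < ?m then 1 else 0)"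
      using p that unfolding tight_ordering_def
      by (cases "k = ?m"; cases "k = 0") simp_all
    then show ?thesis
      using sum_outdegree_prefix[OF T b that] by simp
  qed
  have "int (?d i) = upset_score ?m i" if "i < ?m" for i
    using pre[of i] pre[of "Suc i"] that m unfolding upset_score_def
    by (auto simp: numeral_2_eq_2 split: if_splits)
  then have "(\<Sum>i<?m. (int (?d i))\<^sup>2) = (\<Sum>i<?m. (upset_score ?m i)\<^sup>2)"
    by (intro sum.cong) auto
  then have "int (card (cyclic_triples V A)) = int ?m - 2"
    using cyclic_triples_score[OF T b m] by simp
  then show ?thesis by linarith
qed

lemma finite_enum_mono:
  fixes f :: "'a \<Rightarrow> 'b::linorder"
  assumes "finite V"
  obtains p where "bij_betw p {..<card V} V" "\<And>i j. i \<le> j \<Longrightarrow> j < card V \<Longrightarrow> f (p i) \<le> f (p j)"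
proof -
  obtain xs where xs: "set xs = V" "distinct xs"
    using finite_distinct_list[OF assms] by blast
  define ys where "ys = sort_key f xs"
  have ys: "set ys = V" "distinct ys" "sorted (map f ys)"
    using xs by (auto simp: ys_def)
  then have len: "length ys = card V" using distinct_card by fastforce
  have "bij_betw ((!) ys) {..<card V} V"
    using bij_betw_nth[OF ys(2) _ ys(1)[symmetric]] len by simp
  moreover have "f (ys ! i) \<le> f (ys ! j)" if "i \<le> j" "j < card V" for i j
    using sorted_nth_mono[OF ys(3) that(1)] that len by simp
  ultimately show thesis by (rule that)
qed

text \<open>Enumerate by nondecreasing outdegree. By \<open>strong\<close> every initial segment has
  an outgoing arc, so the scores satisfy the assumptions on \<open>d\<close> above; equality of the
  square sums then fixes the size of each cut.\<close>

lemma strong_tournament_cyclic_triples: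
  assumes T: "tournament (V, A)" and m: "card V \<ge> 3"
    and strong: "\<And>S. S \<noteq> {} \<Longrightarrow> S \<subset> V \<Longrightarrow> A \<inter> S \<times> (V - S) \<noteq> {}"
  shows "card V - 2 \<le> card (cyclic_triples V A)"
    and "card (cyclic_triples V A) = card V - 2 \<Longrightarrow> \<exists>p. tight_ordering V A p"
proof -
  let ?m = "card V"
  note T' = tournamentD[OF T]
  obtain p where p: "bij_betw p {..<?m} V"
    and mono: "\<And>i j. i \<le> j \<Longrightarrow> j < ?m \<Longrightarrow> outdegree (V, A) (p i) \<le> outdegree (V, A) (p j)"
    using finite_enum_mono[OF T'(1), of "outdegree (V, A)"] by blast
  let ?d = "\<lambda>i. int (outdegree (V, A) (p i))"
  let ?cut = "\<lambda>k. A \<inter> p ` {..<k} \<times> (V - p ` {..<k})"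
  have pre: "(\<Sum>i<k. ?d i) = int (k choose 2) + int (card (?cut k))" if "k \<le> ?m" for k
    using arg_cong[OF sum_outdegree_prefix[OF T p that], of int] by simp
  have mono': "?d i \<le> ?d (Suc i)" if "Suc i < ?m" for i
    using mono[of i "Suc i"] that by simp
  have tot: "(\<Sum>i<?m. ?d i) = int (?m choose 2)"
    using pre[of ?m] p by (simp add: bij_betw_def)
  have part: "(\<Sum>i<k. ?d i) > int (k choose 2)" if "0 < k" "k < ?m" for k
  proof -
    have sub: "p ` {..<k} \<subseteq> V" using p that by (auto simp: bij_betw_def)
    have "card (p ` {..<k}) = k"
      using p that by (subst card_image) (auto simp: bij_betw_def intro: inj_on_subset)
    then have "?cut k \<noteq> {}" using that sub by (intro strong) auto
    then have "card (?cut k) > 0" using T'(5) by (simp add: card_gt_0_iff)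
    then show ?thesis using pre[of k] that by simp
  qed
  note score = cyclic_triples_score[OF T p m]
  show "card V - 2 \<le> card (cyclic_triples V A)"
  proof -
    have "(\<Sum>i<?m. (?d i)\<^sup>2) \<le> (\<Sum>i<?m. (upset_score ?m i)\<^sup>2)"
      by (rule score_squares_le[OF m _ tot]) (erule mono', erule part)
    moreover have "v - 2 \<le> c" if "2 * c + x = y + 2 * (v - 2)" "x \<le> y" for c v x y :: int
      using that by simp
    ultimately have "int (card V) - 2 \<le> int (card (cyclic_triples V A))" using score by blast
    then show ?thesis by linarith
  qed
  assume "card (cyclic_triples V A) = card V - 2"
  then have "int (card (cyclic_triples V A)) = int ?m - 2" using m by simp
  then have eq: "(\<Sum>i<?m. (?d i)\<^sup>2) = (\<Sum>i<?m. (upset_score ?m i)\<^sup>2)"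
    using score by simp
  have "card (?cut k) = 1" if "0 < k" "k < ?m" for k
  proof -
    have "(\<Sum>i<k. ?d i) = int (k choose 2) + 1"
      by (rule score_squares_eq_imp[OF m _ tot _ eq that]) (erule mono', erule part)
    then show ?thesis using pre[of k] that by simp
  qed
  then show "\<exists>p. tight_ordering V A p"
    using p unfolding tight_ordering_def by blast
qed

section \<open>Upset tournaments as tight orderings\<close>

lemma path_arcs_simps [simp]:
  "path_arcs [] = {}" "path_arcs [x] = {}"
  "path_arcs (x # y # zs) = insert (x, y) (path_arcs (y # zs))"
  by (simp_all add: path_arcs_def)

lemma path_arcs_Cons: "q \<noteq> [] \<Longrightarrow> path_arcs (x # q) = insert (x, hd q) (path_arcs q)"
  by (cases q) simp_all

lemma path_arcs_subset: "path_arcs q \<subseteq> set q \<times> set q"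
  by (induction q rule: induct_list012) auto

lemma path_arcs_map: "path_arcs (map f q) = map_prod f f ` path_arcs q"
  by (induction q rule: induct_list012) auto

lemma decreasing_path_le_hd:
  fixes f :: "'a \<Rightarrow> nat"
  assumes "\<And>u v. (u, v) \<in> path_arcs q \<Longrightarrow> f v < f u" "x \<in> set q"
  shows "f x \<le> f (hd q)"
  using assms
proof (induction q rule: induct_list012)
  case (3 y z zs)
  have "f z < f y" using "3.prems"(1) by simp
  moreover have "x \<in> set (z # zs) \<Longrightarrow> f x \<le> f z" using "3.IH"(2) "3.prems"(1) by simp
  ultimately show ?case using "3.prems"(2) by force
qed auto

text \<open>The values start at \<open>k\<close> or above and end below it; as they only decrease,
  they cannot climb back for a second crossing.\<close>

lemma decreasing_path_crosses_once:
  fixes f :: "'a \<Rightarrow> nat"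
  assumes "q \<noteq> []" "\<And>u v. (u, v) \<in> path_arcs q \<Longrightarrow> f v < f u" "f (last q) < k" "k \<le> f (hd q)"
  shows "\<exists>!e. e \<in> path_arcs q \<and> f (snd e) < k \<and> k \<le> f (fst e)"
  using assms
proof (induction q rule: induct_list012)
  case (3 x y zs)
  have dec: "\<And>u v. (u, v) \<in> path_arcs (y # zs) \<Longrightarrow> f v < f u" using "3.prems"(2) by simp
  show ?case
  proof (cases "k \<le> f y")
    case True
    then have "\<exists>!e. e \<in> path_arcs (y # zs) \<and> f (snd e) < k \<and> k \<le> f (fst e)"
      using "3.IH"(2) dec "3.prems"(3) by simp
    moreover have "e \<in> path_arcs (x # y # zs) \<and> f (snd e) < k \<and> k \<le> f (fst e) \<longleftrightarrow>
        e \<in> path_arcs (y # zs) \<and> f (snd e) < k \<and> k \<le> f (fst e)" for e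
      using True by auto
    ultimately show ?thesis by simp
  next
    case False
    have "\<not> k \<le> f (fst e)" if "e \<in> path_arcs (y # zs)" for e
      using decreasing_path_le_hd[of "y # zs" f "fst e"] dec path_arcs_subset[of "y # zs"] that False
      by fastforce
    then show ?thesis
      using False "3.prems"(4) by (intro ex1I[of _ "(x, y)"]) auto
  qed
qed auto

text \<open>The arcs crossing the successive cuts tile the interval from 0 to m - 1, hence form a path.\<close>

lemma cut_arcs_form_path:
  fixes U :: "nat rel"
  assumes "m \<ge> 2" and lt: "\<And>i j. (i, j) \<in> U \<Longrightarrow> i < j \<and> j < m"
    and ex1: "\<And>k. 0 < k \<Longrightarrow> k < m \<Longrightarrow> \<exists>!e. e \<in> U \<and> fst e < k \<and> k \<le> snd e"
  obtains q where "q \<noteq> []" "hd q = m - 1" "last q = 0" "path_arcs q = U\<inverse>"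
proof -
  have uniq: "e = e'" if k: "0 < k" "k < m" and e: "e \<in> U" "fst e < k" "k \<le> snd e"
    and e': "e' \<in> U" "fst e' < k" "k \<le> snd e'" for e e' k
  proof -
    from ex1[OF k] obtain z where z: "\<forall>y. y \<in> U \<and> fst y < k \<and> k \<le> snd y \<longrightarrow> y = z"
      by (rule ex1E)
    show ?thesis using z[rule_format, of e] z[rule_format, of e'] e e' by simp
  qed
  \<comment> \<open>Invariant: the arcs starting below \<open>k\<close>, reversed, form a path down
    to 0, and the arc of \<open>U\<close> ending at \<open>hd q\<close> is the one crossing cut
    \<open>k\<close>.\<close>
  have "\<exists>q. q \<noteq> [] \<and> last q = 0 \<and> k \<le> hd q \<and> path_arcs q = {(j, i). (i, j) \<in> U \<and> i < k}
      \<and> (\<exists>i<k. (i, hd q) \<in> U)"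
    if "0 < k" "k < m" for k
    using that
  proof (induction k rule: nat_induct_non_zero)
    case 1
    obtain i j where e: "(i, j) \<in> U" "i < 1" "1 \<le> j"
      using ex1[of 1] 1 by auto
    have "j' = j" if "(0, j') \<in> U" for j'
      using uniq[of 1 "(i, j)" "(0, j')"] e that lt[OF that] 1 by simp
    moreover have "(0, j) \<in> U" using e by simp
    ultimately have "(0, j') \<in> U \<longleftrightarrow> j' = j" for j' by blast
    then have "path_arcs [j, 0] = {(j, i). (i, j) \<in> U \<and> i < 1}" by auto
    then show ?case using e by (intro exI[of _ "[j, 0]"]) auto
  next
    case (Suc k)
    then obtain q i where q: "q \<noteq> []" "last q = 0" "k \<le> hd q"
      "path_arcs q = {(j, i). (i, j) \<in> U \<and> i < k}" "i < k" "(i, hd q) \<in> U" by auto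
    show ?case
    proof (cases "k = hd q")
      case False
      \<comment> \<open>An arc starting at \<open>k\<close> would cross cut \<open>Suc k\<close>,
        which the arc ending at \<open>hd q\<close> already crosses.\<close>
      have "(k, j) \<notin> U" for j
        using uniq[of "Suc k" "(i, hd q)" "(k, j)"] q Suc.prems False lt[of k j] by auto
      then have "{(j, i). (i, j) \<in> U \<and> i < Suc k} = {(j, i). (i, j) \<in> U \<and> i < k}"
        by (auto simp: less_Suc_eq)
      then show ?thesis using q False by (intro exI[of _ q]) auto
    next
      case True
      obtain a b where e: "(a, b) \<in> U" "a < Suc k" "Suc k \<le> b"
        using ex1[of "Suc k"] Suc.prems by auto
      have dec: "\<And>u v. (u, v) \<in> path_arcs q \<Longrightarrow> v < u" using lt q(4) by blast
      \<comment> \<open>All arcs starting below \<open>k\<close> end at or below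
        \<open>hd q = k\<close>, so the arc crossing cut \<open>Suc k\<close> must start at
        \<open>k\<close>; it extends the path.\<close>
      have "a = k"
      proof (rule ccontr)
        assume "a \<noteq> k"
        then have "(b, a) \<in> path_arcs q" using e q(4) by auto
        then have "b \<in> set q" using path_arcs_subset by fastforce
        then have "b \<le> k" using decreasing_path_le_hd[of q "\<lambda>x. x"] dec True by auto
        with e show False by simp
      qed
      have "j = b" if "(k, j) \<in> U" for j
        using uniq[of "Suc k" "(a, b)" "(k, j)"] e that lt[OF that] Suc.prems by simp
      then have "(k, j) \<in> U \<longleftrightarrow> j = b" for j using e(1) \<open>a = k\<close> by blast
      then have "{(j, i). (i, j) \<in> U \<and> i < Suc k} = insert (b, k) {(j, i). (i, j) \<in> U \<and> i < k}"
        by (auto simp: less_Suc_eq)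
      then have "path_arcs (b # q) = {(j, i). (i, j) \<in> U \<and> i < Suc k}"
        using q(1,4) True by (simp add: path_arcs_Cons)
      then show ?thesis using q e \<open>a = k\<close> by (intro exI[of _ "b # q"]) auto
    qed
  qed
  from this[of "m - 1"] assms(1) obtain q where q: "q \<noteq> []" "last q = 0" "m - 1 \<le> hd q"
    "path_arcs q = {(j, i). (i, j) \<in> U \<and> i < m - 1}" "\<exists>i. (i, hd q) \<in> U" by auto
  have "hd q = m - 1" using q(3,5) lt by fastforce
  moreover have "path_arcs q = U\<inverse>" using q(4) lt by fastforce
  ultimately show thesis using q that by blast
qed

text \<open>Outdegree in the transitive tournament is a bijective rank that drops along every arc;
  order the vertices by it. Only reversed arcs go upward, and the path crosses each rank level
  once.\<close>

lemma upset_imp_tight_ordering: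
  assumes "upset_tournament (V, A)"
  shows "\<exists>p. tight_ordering V A p"
proof -
  obtain T q where T: "transitive_tournament T" and q: "directed_path T q"
    and ends: "outdegree T (hd q) = card (fst T) - 1" "outdegree T (last q) = 0"
    and H: "(V, A) = reverse_arcs (path_arcs q) T" and V3: "card V \<ge> 3"
    using assms unfolding upset_tournament_def by auto
  define R where "R = snd T"
  have TR: "T = (V, R)" and A: "A = (R - path_arcs q) \<union> (path_arcs q)\<inverse>"
    using H unfolding reverse_arcs_def R_def by (auto split: prod.splits)
  have "tournament (V, R)" and trans: "trans R"
    using T unfolding transitive_tournament_def TR by simp_all
  note t = tournamentD[OF this(1)]
  have qV: "q \<noteq> []" "path_arcs q \<subseteq> R" using q unfolding directed_path_def TR by auto
  let ?d = "outdegree T" and ?m = "card V"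
  have dec: "?d v < ?d u" if "(u, v) \<in> R" for u v
  proof -
    \<comment> \<open>Transitivity gives the inclusion; \<open>v\<close> itself is an out-neighbour
      of \<open>u\<close> but not of \<open>v\<close>.\<close>
    have "R `` {v} \<subset> R `` {u}" using that trans t(7)[of v] by (auto dest: transD)
    then show ?thesis using t(5) unfolding outdegree_def TR
      by (simp add: psubset_card_mono finite_Image)
  qed
  have bound: "?d v < ?m" if "v \<in> V" for v
  proof -
    have "R `` {v} \<subseteq> V - {v}" using t(2,7) by auto
    then have "card (R `` {v}) \<le> card (V - {v})" using t(1) by (intro card_mono) auto
    then show ?thesis using that t(1) V3 unfolding outdegree_def TR by simp
  qed
  have inj: "inj_on ?d V"
    using t(8) dec by (intro inj_onI) (metis less_irrefl)
  have "?d ` V = {..<?m}"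
    using bound inj by (intro card_subset_eq) (auto simp: card_image)
  then have bij: "bij_betw ?d V {..<?m}" using inj by (simp add: bij_betw_def)
  define p where "p = inv_into V ?d"
  have p: "bij_betw p {..<?m} V" unfolding p_def using bij by (rule bij_betw_inv_into)
  have img: "p ` {..<k} = {v \<in> V. ?d v < k}" if "k < ?m" for k
  proof (intro equalityI subsetI)
    fix v assume "v \<in> p ` {..<k}"
    then obtain i where "i < k" "v = p i" by auto
    moreover from this have "?d v = i"
      using that bij bij_betw_inv_into_right[OF bij] unfolding p_def by simp
    ultimately show "v \<in> {v \<in> V. ?d v < k}"
      using p that by (auto simp: bij_betw_def)
  next
    fix v assume "v \<in> {v \<in> V. ?d v < k}"
    then show "v \<in> p ` {..<k}"
      using bij_betw_inv_into_left[OF bij] unfolding p_def by force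
  qed
  have "card (A \<inter> p ` {..<k} \<times> (V - p ` {..<k})) = 1" if k: "0 < k" "k < ?m" for k
  proof -
    have "\<exists>!e. e \<in> path_arcs q \<and> ?d (snd e) < k \<and> k \<le> ?d (fst e)"
      using qV dec ends k unfolding TR
      by (intro decreasing_path_crosses_once) auto
    then obtain a b where ab: "(a, b) \<in> path_arcs q" "?d b < k" "k \<le> ?d a"
      and uniq: "\<forall>e. e \<in> path_arcs q \<and> ?d (snd e) < k \<and> k \<le> ?d (fst e) \<longrightarrow> e = (a, b)"
      by (auto simp: Ex1_def)
    have "A \<inter> p ` {..<k} \<times> (V - p ` {..<k}) = {(b, a)}"
    proof (intro equalityI subsetI)
      fix e assume "e \<in> A \<inter> p ` {..<k} \<times> (V - p ` {..<k})"
      then obtain u v where e: "e = (u, v)" "(u, v) \<in> A" "?d u < k" "\<not> ?d v < k"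
        unfolding img[OF k(2)] by auto
      then have "(v, u) \<in> path_arcs q" using dec[of u v] unfolding A by auto
      then show "e \<in> {(b, a)}" using uniq[rule_format, of "(v, u)"] e by auto
    next
      fix e assume "e \<in> {(b, a)}"
      then show "e \<in> A \<inter> p ` {..<k} \<times> (V - p ` {..<k})"
        using ab qV(2) t(2) unfolding img[OF k(2)] A by auto
    qed
    then show ?thesis by simp
  qed
  then show ?thesis using p unfolding tight_ordering_def by blast
qed

lemma bij_betw_lessThan_suffix:
  fixes p :: "nat \<Rightarrow> 'a"
  assumes "bij_betw p {..<m} V" "k \<le> m"
  shows "V - p ` {..<k} = p ` {k..<m}"
proof -
  have "p ` ({..<m} - {..<k}) = p ` {..<m} - p ` {..<k}"
    using assms by (intro inj_on_image_set_diff[of p "{..<m}"]) (auto simp: bij_betw_def)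
  moreover have "{..<m} - {..<k} = {k..<m}" by auto
  ultimately show ?thesis using assms(1) by (simp add: bij_betw_def)
qed

text \<open>Transfers the cut condition from vertices to positions, the form used by
  \<open>cut_arcs_form_path\<close>.\<close>

lemma tight_ordering_crosses_once:
  assumes p: "tight_ordering V A p" and k: "0 < k" "k < card V"
  shows "\<exists>!e. e \<in> {(i, j). i < j \<and> j < card V \<and> (p i, p j) \<in> A} \<and> fst e < k \<and> k \<le> snd e"
proof -
  have b: "inj_on p {..<card V}" "p ` {..<card V} = V"
    using p unfolding tight_ordering_def bij_betw_def by auto
  have rest: "V - p ` {..<k} = p ` {k..<card V}"
    using p k by (intro bij_betw_lessThan_suffix) (simp_all add: tight_ordering_def)
  have "card (A \<inter> p ` {..<k} \<times> (p ` {k..<card V})) = 1"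
    using p k unfolding tight_ordering_def rest[symmetric] by simp
  then obtain e where e: "A \<inter> p ` {..<k} \<times> (p ` {k..<card V}) = {e}"
    by (auto simp: card_1_singleton_iff)
  then have "e \<in> A \<inter> p ` {..<k} \<times> (p ` {k..<card V})" by simp
  then obtain i j where ij: "i < k" "k \<le> j" "j < card V" "(p i, p j) \<in> A" "e = (p i, p j)"
    by auto
  show ?thesis
  proof (rule ex1I[of _ "(i, j)"])
    fix f assume f: "f \<in> {(i, j). i < j \<and> j < card V \<and> (p i, p j) \<in> A} \<and> fst f < k \<and> k \<le> snd f"
    obtain i' j' where f': "f = (i', j')" by (cases f)
    have "(p i', p j') \<in> A \<inter> p ` {..<k} \<times> (p ` {k..<card V})"
      using f unfolding f' by auto
    then have "p i' = p i" "p j' = p j" unfolding e ij(5) by auto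
    then show "f = (i, j)"
      using inj_onD[OF b(1)] f ij k unfolding f' by auto
  qed (use ij in auto)
qed

text \<open>The arcs of \<open>A\<close> from a lower to a higher position form, when reversed, a
  path from the top position to 0. Reversing that path in the transitive tournament on the positions
  gives back \<open>A\<close>.\<close>

lemma tight_ordering_imp_upset:
  assumes T: "tournament (V, A)" and p: "tight_ordering V A p" and m: "card V \<ge> 3"
  shows "upset_tournament (V, A)"
proof -
  let ?m = "card V"
  note t = tournamentD[OF T]
  have inj: "inj_on p {..<?m}" and img: "p ` {..<?m} = V"
    using p unfolding tight_ordering_def bij_betw_def by auto
  have pinj: "p i = p j \<longleftrightarrow> i = j" if "i < ?m" "j < ?m" for i j
    using inj that by (auto dest: inj_onD)
  have pV: "i < ?m \<Longrightarrow> p i \<in> V" for i using img by auto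
  define U where "U = {(i, j). i < j \<and> j < ?m \<and> (p i, p j) \<in> A}"
  obtain q where q: "q \<noteq> []" "hd q = ?m - 1" "last q = 0" "path_arcs q = U\<inverse>"
  proof (rule cut_arcs_form_path[of ?m U])
    show "\<exists>!e. e \<in> U \<and> fst e < k \<and> k \<le> snd e" if "0 < k" "k < ?m" for k
      using tight_ordering_crosses_once[OF p that] unfolding U_def .
  qed (use m in \<open>auto simp: U_def\<close>)
  \<comment> \<open>Arcs point to smaller positions, so that the position of a vertex is its
    outdegree and the path starts at outdegree m - 1.\<close>
  define R where "R = {(p j, p i) |i j. i < j \<and> j < ?m}"
  have R_iff: "(p i, p j) \<in> R \<longleftrightarrow> j < i" if "i < ?m" "j < ?m" for i j
    unfolding R_def using pinj that by (auto 4 4)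
  have V_E: "\<exists>i<?m. v = p i" if "v \<in> V" for v using img that by auto
  have RV: "R \<subseteq> V \<times> V" unfolding R_def using pV by auto
  have R_E: "\<exists>i j. u = p i \<and> v = p j \<and> j < i \<and> i < ?m" if "(u, v) \<in> R" for u v
    using that unfolding R_def by auto
  have "tournament (V, R)"
    unfolding tournament_def prod.case
  proof (intro conjI)
    show "asym R"
    proof (rule asymI)
      fix u v assume "(u, v) \<in> R"
      then obtain i j where "u = p i" "v = p j" "j < i" "i < ?m" using R_E by blast
      then show "(v, u) \<notin> R" using R_iff[of j i] by simp
    qed
    show "total_on V R"
    proof (rule total_onI)
      fix u v assume "u \<in> V" "v \<in> V" "u \<noteq> v"
      then obtain i j where "u = p i" "v = p j" "i < ?m" "j < ?m" "i \<noteq> j" using V_E by metis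
      then show "(u, v) \<in> R \<or> (v, u) \<in> R" using R_iff[of i j] R_iff[of j i] by auto
    qed
  qed (use t(1) RV in auto)
  moreover have "trans R"
  proof (rule transI)
    fix u v w assume uv: "(u, v) \<in> R" "(v, w) \<in> R"
    obtain i j where ij: "u = p i" "v = p j" "j < i" "i < ?m" using R_E[OF uv(1)] by blast
    obtain j' l where jl: "v = p j'" "w = p l" "l < j'" "j' < ?m" using R_E[OF uv(2)] by blast
    have "j = j'" using ij jl pinj[of j j'] by simp
    then show "(u, w) \<in> R" using ij jl R_iff[of i l] by simp
  qed
  ultimately have trans: "transitive_tournament (V, R)"
    unfolding transitive_tournament_def by simp
  have outdeg: "outdegree (V, R) (p i) = i" if "i < ?m" for i
  proof -
    have "R `` {p i} = p ` {..<i}"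
    proof (intro equalityI subsetI)
      fix v assume "v \<in> R `` {p i}"
      then have "(p i, v) \<in> R" by simp
      then obtain a b where "p i = p a" "v = p b" "b < a" "a < ?m" using R_E by blast
      then show "v \<in> p ` {..<i}" using pinj[of i a] that by auto
    next
      fix v assume "v \<in> p ` {..<i}"
      then show "v \<in> R `` {p i}" using R_iff[of i] that by auto
    qed
    moreover have "inj_on p {..<i}" using inj that by (auto intro: inj_on_subset)
    ultimately show ?thesis by (simp add: outdegree_def card_image)
  qed
  have q_lt: "set q \<subseteq> {..<?m}"
  proof
    fix x assume "x \<in> set q"
    then have "x \<le> hd q"
      using decreasing_path_le_hd[of q "\<lambda>x. x"] q(4) by (auto simp: U_def)
    then show "x \<in> {..<?m}" using q(2) m by simp
  qed
  have q_dist: "distinct q"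
  proof -
    have "distinct q" if "\<And>u v. (u, v) \<in> path_arcs q \<Longrightarrow> v < u" for q :: "nat list"
      using that
    proof (induction q rule: induct_list012)
      case (3 x y zs)
      have "\<And>u v. (u, v) \<in> path_arcs (y # zs) \<Longrightarrow> v < u" using 3(3) by simp
      moreover from this have "z \<le> y" if "z \<in> set (y # zs)" for z
        using decreasing_path_le_hd[of "y # zs" "\<lambda>x. x" z] that by simp
      moreover have "y < x" using 3(3) by simp
      ultimately show ?case using 3(2) by fastforce
    qed auto
    then show ?thesis using q(4) by (auto simp: U_def)
  qed
  have arcs: "path_arcs (map p q) = {(p j, p i) |i j. (i, j) \<in> U}"
    unfolding path_arcs_map q(4) by (auto simp: image_iff)
  have "directed_path (V, R) (map p q)"
    unfolding directed_path_def
  proof (intro conjI)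
    show "distinct (map p q)"
      using q_dist q_lt inj by (auto simp: distinct_map intro: inj_on_subset)
    show "path_arcs (map p q) \<subseteq> snd (V, R)"
      unfolding arcs R_def U_def by auto
  qed (use q q_lt pV in auto)
  moreover have "(V, A) = reverse_arcs (path_arcs (map p q)) (V, R)"
  proof -
    have "A = (R - path_arcs (map p q)) \<union> (path_arcs (map p q))\<inverse>"
    proof (intro equalityI subsetI)
      fix e assume "e \<in> A"
      then obtain i j where e: "e = (p i, p j)" "(p i, p j) \<in> A" "i < ?m" "j < ?m"
        using t(2) V_E by blast
      have "i \<noteq> j" using e t(7) by auto
      show "e \<in> (R - path_arcs (map p q)) \<union> (path_arcs (map p q))\<inverse>"
      proof (cases "i < j")
        case True
        then show ?thesis using e unfolding arcs U_def by auto
      next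
        case False
        with \<open>i \<noteq> j\<close> have "(p i, p j) \<in> R" using R_iff e by simp
        moreover have "(p i, p j) \<notin> path_arcs (map p q)"
          using t(6)[OF e(2)] unfolding arcs U_def by auto
        ultimately show ?thesis using e by simp
      qed
    next
      fix e assume e: "e \<in> (R - path_arcs (map p q)) \<union> (path_arcs (map p q))\<inverse>"
      show "e \<in> A"
      proof (cases "e \<in> (path_arcs (map p q))\<inverse>")
        case True
        then show ?thesis unfolding arcs U_def by auto
      next
        case False
        with e obtain i j where ij: "e = (p i, p j)" "j < i" "i < ?m" "e \<notin> path_arcs (map p q)"
          unfolding R_def by auto
        have "(p j, p i) \<notin> A" using ij unfolding arcs U_def by auto
        moreover have "p i \<noteq> p j" using ij pinj by simp
        ultimately show ?thesis using t(8)[of "p i" "p j"] ij pV by auto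
      qed
    qed
    then show ?thesis by (simp add: reverse_arcs_def)
  qed
  moreover have "outdegree (V, R) (hd (map p q)) = card (fst (V, R)) - 1"
    "outdegree (V, R) (last (map p q)) = 0"
    using q m outdeg[of "?m - 1"] outdeg[of 0] by (simp_all add: hd_map last_map)
  ultimately show ?thesis
    using trans m unfolding upset_tournament_def by (metis fst_conv)
qed

section \<open>Nonsingularity\<close>

text \<open>The bound 5 is sharp: it fails for m = 6 when the upward arcs are those from i to i + 1.\<close>

lemma unique_crossings_kernel_trivial:
  fixes a :: "nat \<Rightarrow> nat \<Rightarrow> bool" and y :: "nat \<Rightarrow> real"
  assumes m: "3 \<le> m" "m \<le> 5"
    and cut: "\<And>k. 0 < k \<Longrightarrow> k < m \<Longrightarrow> (\<Sum>i<k. \<Sum>j=k..<m. of_bool (a i j)) = (1::real)"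
    and flip: "\<And>i j. i < j \<Longrightarrow> j < m \<Longrightarrow> a j i \<longleftrightarrow> \<not> a i j" and irr: "\<And>i. \<not> a i i"
    and row: "\<And>i. i < m \<Longrightarrow> (\<Sum>j<m. if a i j then y j else 0) = 0"
    and i: "i < m"
  shows "y i = 0"
proof -
  consider "m = 3" | "m = 4" | "m = 5" using m by linarith
  then show ?thesis
  proof cases
    case 1
    \<comment> \<open>For a fixed order the cut equations leave finitely many arc patterns, and in
      each the row equations force zero. The cut sums are real-valued, so \<open>argo\<close> can
      treat both kinds of equation as linear real constraints.\<close>
    have "y 0 = 0 \<and> y 1 = 0 \<and> y 2 = 0"
      using cut[of 1] cut[of 2] row[of 0] row[of 1] row[of 2] flip[of 0 1] flip[of 0 2] flip[of 1 2] irr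
      unfolding 1 of_bool_def by (simp add: eval_nat_numeral) argo
    then show ?thesis using i 1 by (auto simp: less_Suc_eq eval_nat_numeral)
  next
    case 2
    have "y 0 = 0 \<and> y 1 = 0 \<and> y 2 = 0 \<and> y 3 = 0"
      using cut[of 1] cut[of 2] cut[of 3] row[of 0] row[of 1] row[of 2] row[of 3]
        flip[of 0 1] flip[of 0 2] flip[of 0 3] flip[of 1 2] flip[of 1 3] flip[of 2 3] irr
      unfolding 2 of_bool_def by (simp add: eval_nat_numeral) argo
    then show ?thesis using i 2 by (auto simp: less_Suc_eq eval_nat_numeral)
  next
    case 3
    have "y 0 = 0 \<and> y 1 = 0 \<and> y 2 = 0 \<and> y 3 = 0 \<and> y 4 = 0"
      using cut[of 1] cut[of 2] cut[of 3] cut[of 4]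
        row[of 0] row[of 1] row[of 2] row[of 3] row[of 4]
        flip[of 0 1] flip[of 0 2] flip[of 0 3] flip[of 0 4]
        flip[of 1 2] flip[of 1 3] flip[of 1 4]
        flip[of 2 3] flip[of 2 4] flip[of 3 4] irr
      unfolding 3 of_bool_def by (simp add: eval_nat_numeral) argo
    then show ?thesis using i 3 by (auto simp: less_Suc_eq eval_nat_numeral)
  qed
qed

text \<open>Injectivity of the adjacency matrix, phrased with functions on vertices so that a
  component with arbitrary vertex numbers needs no reindexed submatrix.\<close>

definition trivial_kernel :: "'a set \<Rightarrow> 'a rel \<Rightarrow> bool" where
  "trivial_kernel V A \<longleftrightarrow>
     (\<forall>x :: 'a \<Rightarrow> real. (\<forall>u\<in>V. (\<Sum>v\<in>A `` {u}. x v) = 0) \<longrightarrow> (\<forall>v\<in>V. x v = 0))"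

lemma tight_ordering_trivial_kernel:
  assumes T: "tournament (V, A)" and p: "tight_ordering V A p" and m: "3 \<le> card V" "card V \<le> 5"
  shows "trivial_kernel V A"
  unfolding trivial_kernel_def
proof (intro allI impI ballI)
  fix x :: "'a \<Rightarrow> real" and w
  assume ker: "\<forall>u\<in>V. (\<Sum>v\<in>A `` {u}. x v) = 0" and w: "w \<in> V"
  note t = tournamentD[OF T]
  let ?m = "card V"
  have bij: "bij_betw p {..<?m} V" using p by (simp add: tight_ordering_def)
  then have inj: "inj_on p {..<?m}" and img: "p ` {..<?m} = V" by (auto simp: bij_betw_def)
  have pV: "i < ?m \<Longrightarrow> p i \<in> V" for i using img by auto
  obtain i where i: "i < ?m" "w = p i" using w img by auto
  have "x (p i) = 0"
  proof (rule unique_crossings_kernel_trivial[OF m, of "\<lambda>i j. (p i, p j) \<in> A"])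
    show "(\<Sum>i<k. \<Sum>j=k..<?m. of_bool ((p i, p j) \<in> A)) = (1::real)" if k: "0 < k" "k < ?m" for k
    proof -
      let ?X = "p ` {..<k}" and ?Y = "p ` {k..<?m}"
      have "1 = real (card (A \<inter> ?X \<times> ?Y))"
        using p k unfolding tight_ordering_def
        by (simp add: bij_betw_lessThan_suffix[OF bij, of k, symmetric])
      also have "\<dots> = (\<Sum>e\<in>?X \<times> ?Y. of_bool (e \<in> A))"
        by (simp add: of_bool_def sum.If_cases Int_commute)
      also have "\<dots> = (\<Sum>u\<in>?X. \<Sum>v\<in>?Y. of_bool ((u, v) \<in> A))"
        unfolding sum.cartesian_product by (rule sum.cong) auto
      also have "\<dots> = (\<Sum>i<k. \<Sum>v\<in>?Y. of_bool ((p i, v) \<in> A))"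
        using inj k by (subst sum.reindex) (auto intro: inj_on_subset)
      also have "\<dots> = (\<Sum>i<k. \<Sum>j=k..<?m. of_bool ((p i, p j) \<in> A))"
        using inj k by (intro sum.cong refl, subst sum.reindex) (auto intro: inj_on_subset)
      finally show ?thesis by simp
    qed
    show "(p j, p i) \<in> A \<longleftrightarrow> (p i, p j) \<notin> A" if "i < j" "j < ?m" for i j
      using t(6)[of "p i" "p j"] t(8)[of "p i" "p j"] inj_onD[OF inj, of i j] pV that by auto
    show "(\<Sum>j<?m. if (p i, p j) \<in> A then x (p j) else 0) = 0" if "i < ?m" for i
    proof -
      have "(\<Sum>j<?m. if (p i, p j) \<in> A then x (p j) else 0) = (\<Sum>v\<in>V. if (p i, v) \<in> A then x v else 0)"
        by (rule sum.reindex_bij_betw[OF bij])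
      also have "\<dots> = (\<Sum>v\<in>V \<inter> {v. (p i, v) \<in> A}. x v)"
        using t(1) by (simp add: sum.If_cases)
      also have "V \<inter> {v. (p i, v) \<in> A} = A `` {p i}" using t(2) by auto
      finally show ?thesis using ker pV[OF that] by simp
    qed
  qed (use i t(7) in auto)
  then show "x w = 0" using i by simp
qed

section \<open>Determinants and the tournament of a matrix\<close>

lemma invertible_mat_iff_det:
  fixes M :: "'a::field mat"
  assumes "M \<in> carrier_mat n n"
  shows "invertible_mat M \<longleftrightarrow> det M \<noteq> 0"
proof
  assume "invertible_mat M"
  then obtain B where B: "M * B = 1\<^sub>m (dim_row M)" "B * M = 1\<^sub>m (dim_row B)"
    unfolding invertible_mat_def inverts_mat_def by blast
  have r: "dim_row B = n" 
    using arg_cong[OF B(2), of dim_col] assms by auto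
  have c: "dim_col B = n"
    using arg_cong[OF B(1), of dim_col] assms by auto
  have "det M * det B = 1"
    using det_mult[OF assms, of B] B(1) r c assms by auto
  then show "det M \<noteq> 0" by auto
next
  assume "det M \<noteq> 0"
  then have "M \<in> Units (ring_mat TYPE('a) n ())"
    by (rule det_non_zero_imp_unit[OF assms])
  then show "invertible_mat M"
    using assms unfolding Units_def invertible_mat_def inverts_mat_def
    by (auto simp: ring_mat_simps)
qed

lemma tournament_mat_entry:
  assumes "M \<in> tournament_mats n" "i < n" "j < n"
  shows "M $$ (i, j) = of_bool ((i, j) \<in> mat_arcs M)"
proof -
  have M: "M \<in> carrier_mat n n" "elements_mat M \<subseteq> {0, 1}"
    using assms(1) unfolding tournament_mats_def by auto
  then have "M $$ (i, j) \<in> {0, 1}" using assms(2,3) elements_matI[OF M(1)] by blast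
  then show ?thesis using M(1) assms(2,3) by (auto simp: mat_arcs_def mat_verts_def)
qed

lemma tournament_of_mat:
  assumes "M \<in> tournament_mats n"
  shows "tournament (mat_verts M, mat_arcs M)"
proof -
  have M: "M \<in> carrier_mat n n" and sum: "M + transpose_mat M = all_ones_mat n - 1\<^sub>m n"
    using assms unfolding tournament_mats_def by auto
  have V: "mat_verts M = {0..<n}" using M by (auto simp: mat_verts_def)
  have s: "of_bool ((i, j) \<in> mat_arcs M) + of_bool ((j, i) \<in> mat_arcs M) = (if i = j then 0 else 1 :: real)"
    if "i < n" "j < n" for i j
    using arg_cong[OF sum, of "\<lambda>B. B $$ (i, j)"] M that tournament_mat_entry[OF assms]
    by (auto simp: all_ones_mat_def)
  have sub: "mat_arcs M \<subseteq> mat_verts M \<times> mat_verts M" by (auto simp: mat_arcs_def)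
  show ?thesis
    unfolding tournament_def prod.case
  proof (intro conjI)
    show "asym (mat_arcs M)"
    proof (rule asymI)
      fix i j assume a: "(i, j) \<in> mat_arcs M"
      then have "i < n" "j < n" using sub V by auto
      then show "(j, i) \<notin> mat_arcs M" using s[of i j] a by (auto split: if_splits)
    qed
    show "total_on (mat_verts M) (mat_arcs M)"
    proof (rule total_onI)
      fix i j assume "i \<in> mat_verts M" "j \<in> mat_verts M" "i \<noteq> j"
      then show "(i, j) \<in> mat_arcs M \<or> (j, i) \<in> mat_arcs M"
        using s[of i j] V by (auto split: if_splits)
    qed
  qed (use sub V in auto)
qed

section \<open>Strong components\<close>

lemma equiv_mutually_reachable: "equiv (mat_verts M) (mutually_reachable M)"
  unfolding mutually_reachable_def
  by (rule equivI) (auto simp: refl_on_def sym_def trans_def intro: rtrancl_trans)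

abbreviation components :: "real mat \<Rightarrow> nat set set" where
  "components M \<equiv> mat_verts M // mutually_reachable M"

lemma componentD:
  assumes "C \<in> components M"
  shows "C \<subseteq> mat_verts M" "C \<noteq> {}"
    "\<And>u v. u \<in> C \<Longrightarrow> v \<in> C \<longleftrightarrow> (u, v) \<in> mutually_reachable M"
proof -
  note e = equiv_mutually_reachable[of M]
  show "C \<subseteq> mat_verts M" using in_quotient_imp_subset[OF e assms] .
  show "C \<noteq> {}" using in_quotient_imp_non_empty[OF e assms] .
  show "v \<in> C \<longleftrightarrow> (u, v) \<in> mutually_reachable M" if "u \<in> C" for u v
    using in_quotient_imp_in_rel[OF e assms] in_quotient_imp_closed[OF e assms] that by blast
qed

lemma components_disjoint:
  assumes "C \<in> components M" "D \<in> components M" "u \<in> C" "u \<in> D"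
  shows "C = D"
  using quotient_disj[OF equiv_mutually_reachable assms(1,2)] assms(3,4) by blast

lemma component_of:
  assumes "v \<in> mat_verts M"
  obtains C where "C \<in> components M" "v \<in> C"
  using assms equiv_mutually_reachable[of M] by (metis Union_iff Union_quotient)

lemma finite_components: "finite (components M)"
  using finite_quotient[of "mat_verts M" "mutually_reachable M"] equiv_mutually_reachable[of M]
  by (auto simp: mat_verts_def equiv_def refl_on_def)

lemma sum_card_components: "(\<Sum>C\<in>components M. card C) = dim_row M"
proof -
  have "card (\<Union>(components M)) = (\<Sum>C\<in>components M. card C)"
  proof (rule card_Union_disjoint)
    show "pairwise disjnt (components M)"
      using components_disjoint[of _ M] unfolding pairwise_def disjnt_def by blast
    show "finite C" if "C \<in> components M" for C
      using componentD(1)[OF that] by (auto simp: mat_verts_def intro: finite_subset)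
  qed
  then show ?thesis
    using Union_quotient[OF equiv_mutually_reachable[of M]] by (simp add: mat_verts_def)
qed

text \<open>The reachability of both ends of the exit arc is recorded in order to show later that
  the arc stays inside a strong component.\<close>

lemma rtrancl_exits:
  assumes "(u, w) \<in> A\<^sup>*" "u \<in> S" "w \<notin> S"
  shows "\<exists>a b. (a, b) \<in> A \<and> a \<in> S \<and> b \<notin> S \<and> (u, a) \<in> A\<^sup>* \<and> (b, w) \<in> A\<^sup>*"
  using assms
proof (induction rule: converse_rtrancl_induct)
  case (step y z)
  show ?case
  proof (cases "z \<in> S")
    case True
    then show ?thesis using step by (meson converse_rtrancl_into_rtrancl)
  next
    case False
    then show ?thesis using step by blast
  qed
qed simp

text \<open>A walk from \<open>S\<close> to the rest of \<open>C\<close> leaves \<open>S\<close>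
  along some arc; the end of that arc lies on a closed walk through \<open>u\<close>, hence in
  \<open>C\<close>.\<close>

lemma component_strong:
  assumes C: "C \<in> components M" and S: "S \<noteq> {}" "S \<subset> C"
  shows "(mat_arcs M \<inter> C \<times> C) \<inter> S \<times> (C - S) \<noteq> {}"
proof -
  note c = componentD[OF C]
  obtain u w where uw: "u \<in> S" "w \<in> C" "w \<notin> S" using S by blast
  then have uC: "u \<in> C" using S by blast
  have r: "(u, w) \<in> (mat_arcs M)\<^sup>*" "(w, u) \<in> (mat_arcs M)\<^sup>*"
    using c(3)[OF uC] uw unfolding mutually_reachable_def by auto
  obtain a b where ab: "(a, b) \<in> mat_arcs M" "a \<in> S" "b \<notin> S" "(u, a) \<in> (mat_arcs M)\<^sup>*" "(b, w) \<in> (mat_arcs M)\<^sup>*"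
    using rtrancl_exits[OF r(1) uw(1,3)] by blast
  have "(u, b) \<in> (mat_arcs M)\<^sup>*" "(b, u) \<in> (mat_arcs M)\<^sup>*"
    using ab r by (auto intro: rtrancl_into_rtrancl rtrancl_trans)
  moreover have "b \<in> mat_verts M" "u \<in> mat_verts M"
    using ab(1) uC c(1) by (auto simp: mat_arcs_def)
  ultimately have "b \<in> C" using c(3)[OF uC] by (auto simp: mutually_reachable_def)
  then show ?thesis using ab S(2) by blast
qed

text \<open>Two vertices forming a component would need arcs in both directions.\<close>

lemma component_card_ge_3:
  assumes M: "M \<in> tournament_mats n" and C: "C \<in> components M" and "card C \<noteq> 1"
  shows "card C \<ge> 3"
proof -
  note c = componentD[OF C] and t = tournamentD[OF tournament_of_mat[OF M]]
  have "finite C" using c(1) t(1) finite_subset by blast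
  then have "card C \<noteq> 0" using c(2) by simp
  moreover have "card C \<noteq> 2"
  proof
    assume "card C = 2"
    then obtain u v where uv: "C = {u, v}" "u \<noteq> v" by (auto simp: card_2_iff)
    have "(u, v) \<in> mat_arcs M" "(v, u) \<in> mat_arcs M"
      using component_strong[OF C, of "{u}"] component_strong[OF C, of "{v}"] uv by auto
    then show False using t(6) by blast
  qed
  ultimately show ?thesis using assms(3) by linarith
qed

text \<open>The vertices of a directed 3-cycle reach each other, so each cycle lies in a single
  component.\<close>

lemma num_3cycles_components:
  "num_3cycles M = (\<Sum>C\<in>components M. card (cyclic_triples C (mat_arcs M \<inter> C \<times> C)))"
proof -
  let ?A = "mat_arcs M" and ?V = "mat_verts M"
  have "cyclic_triples ?V ?A = (\<Union>C\<in>components M. cyclic_triples C (?A \<inter> C \<times> C))"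
  proof (intro equalityI subsetI)
    fix S assume "S \<in> cyclic_triples ?V ?A"
    then obtain u v w where S: "S = {u, v, w}" "(u, v) \<in> ?A" "(v, w) \<in> ?A" "(w, u) \<in> ?A"
      "S \<subseteq> ?V" "card S = 3" unfolding cyclic_triples_def by auto
    then have "u \<in> ?V" by simp
    then obtain C where C: "C \<in> components M" "u \<in> C" by (rule component_of)
    have "(u, v) \<in> ?A\<^sup>*" "(v, u) \<in> ?A\<^sup>*" "(u, w) \<in> ?A\<^sup>*" "(w, u) \<in> ?A\<^sup>*"
      using S(2-4) by (meson r_into_rtrancl rtrancl_trans)+
    then have "v \<in> C" "w \<in> C"
      using componentD(3)[OF C] S(1,5) by (auto simp: mutually_reachable_def)
    then have "S \<in> cyclic_triples C (?A \<inter> C \<times> C)"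
      unfolding cyclic_triples_def using S C(2) by blast
    then show "S \<in> (\<Union>C\<in>components M. cyclic_triples C (?A \<inter> C \<times> C))" using C(1) by blast
  next
    fix S assume "S \<in> (\<Union>C\<in>components M. cyclic_triples C (?A \<inter> C \<times> C))"
    then obtain C where "C \<in> components M" "S \<in> cyclic_triples C (?A \<inter> C \<times> C)" by blast
    then show "S \<in> cyclic_triples ?V ?A"
      using componentD(1)[of C M] unfolding cyclic_triples_def by blast
  qed
  then have "num_3cycles M = card (\<Union>C\<in>components M. cyclic_triples C (?A \<inter> C \<times> C))"
    unfolding num_3cycles_def cyclic_triples_def[symmetric] by simp
  also have "\<dots> = (\<Sum>C\<in>components M. card (cyclic_triples C (?A \<inter> C \<times> C)))"
  proof (rule card_UN_disjoint[OF finite_components]; intro ballI impI)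
    fix C assume C: "C \<in> components M"
    have "finite C" using componentD(1)[OF C] by (auto simp: mat_verts_def intro: finite_subset)
    then show "finite (cyclic_triples C (?A \<inter> C \<times> C))"
      by (rule finite_subset[rotated, OF finite_Pow_iff[THEN iffD2]]) (auto simp: cyclic_triples_def)
    fix D assume D: "D \<in> components M" "C \<noteq> D"
    show "cyclic_triples C (?A \<inter> C \<times> C) \<inter> cyclic_triples D (?A \<inter> D \<times> D) = {}"
    proof (rule equals0I)
      fix S assume "S \<in> cyclic_triples C (?A \<inter> C \<times> C) \<inter> cyclic_triples D (?A \<inter> D \<times> D)"
      then have "S \<subseteq> C" "S \<subseteq> D" "card S = 3" unfolding cyclic_triples_def by auto
      then obtain u where "u \<in> C" "u \<in> D" by (metis card.empty equals0I subsetD zero_neq_numeral)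
      then show False using components_disjoint[OF C D(1)] D(2) by blast
    qed
  qed
  finally show ?thesis .
qed

text \<open>The rows of the vertices reachable from v are supported on those vertices other than v.\<close>

lemma singleton_component_imp_det_0:
  assumes M: "M \<in> tournament_mats n" and v: "{v} \<in> components M"
  shows "det M = 0"
proof -
  have carr: "M \<in> carrier_mat n n" using M by (simp add: tournament_mats_def)
  then have V: "mat_verts M = {0..<n}" by (auto simp: mat_verts_def)
  note t = tournamentD[OF tournament_of_mat[OF M]]
  have vV: "v \<in> mat_verts M" using componentD(1)[OF v] by simp
  define R where "R = {w \<in> mat_verts M. (v, w) \<in> (mat_arcs M)\<^sup>*}"
  have fR: "finite R" and vR: "v \<in> R" using V vV by (auto simp: R_def)
  \<comment> \<open>Leibniz expansion: a permutation with nonzero product follows arcs, so it would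
    map \<open>R\<close> injectively into \<open>R - {v}\<close>.\<close>
  have "(\<Prod>i = 0..<n. M $$ (i, f i)) = 0" if f: "f permutes {0..<n}" for f
  proof (rule ccontr)
    assume nz: "(\<Prod>i = 0..<n. M $$ (i, f i)) \<noteq> 0"
    have arc: "(i, f i) \<in> mat_arcs M" if "i < n" for i
    proof -
      have "f i < n" using permutes_in_image[OF f, of i] that by simp
      moreover have "M $$ (i, f i) \<noteq> 0" using nz that by simp
      ultimately show ?thesis using tournament_mat_entry[OF M that] by auto
    qed
    have "f i \<in> R - {v}" if "i \<in> R" for i
    proof -
      have i: "i \<in> mat_verts M" "(v, i) \<in> (mat_arcs M)\<^sup>*" "(i, f i) \<in> mat_arcs M"
        using that arc[of i] V by (auto simp: R_def)
      \<comment> \<open>An arc from \<open>i\<close> back to \<open>v\<close> would put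
        \<open>i\<close> in the component of \<open>v\<close>, hence \<open>i = v\<close>, and there
        are no loops.\<close>
      have "f i \<noteq> v"
      proof
        assume "f i = v"
        then have "(v, i) \<in> mutually_reachable M"
          using i vV by (auto simp: mutually_reachable_def)
        then have "i = v" using componentD(3)[OF v, of v i] by simp
        then show False using i(3) \<open>f i = v\<close> t(7) by simp
      qed
      then show ?thesis using i t(2) by (auto simp: R_def intro: rtrancl_into_rtrancl)
    qed
    then have "card (f ` R) \<le> card (R - {v})" using fR by (intro card_mono) auto
    moreover have "card (f ` R) = card R"
      by (rule card_image) (meson f inj_on_subset permutes_inj subset_UNIV)
    ultimately show False using fR vR by (metis card_Diff1_less not_le)
  qed
  then show ?thesis
    unfolding det_def'[OF carr] by (intro sum.neutral) (simp del: prod_zero_iff)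
qed

text \<open>The matrix is block triangular along reachability of components. A nonzero kernel vector
  restricts to a nonzero kernel vector of one suitably chosen component.\<close>

lemma trivial_kernel_components_imp_det:
  assumes M: "M \<in> tournament_mats n"
    and ker: "\<And>C. C \<in> components M \<Longrightarrow> trivial_kernel C (mat_arcs M \<inter> C \<times> C)"
  shows "det M \<noteq> 0"
proof
  assume "det M = 0"
  let ?A = "mat_arcs M"
  have carr: "M \<in> carrier_mat n n" using M by (simp add: tournament_mats_def)
  then have V: "mat_verts M = {0..<n}" by (auto simp: mat_verts_def)
  note t = tournamentD[OF tournament_of_mat[OF M]]
  from \<open>det M = 0\<close> obtain z where z: "z \<in> carrier_vec n" "z \<noteq> 0\<^sub>v n" "M *\<^sub>v z = 0\<^sub>v n"
    using det_0_iff_vec_prod_zero[OF carr] by blast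
  define x where "x i = z $ i" for i
  have row: "(\<Sum>v\<in>?A `` {u}. x v) = 0" if "u < n" for u
  proof -
    have "0 = (M *\<^sub>v z) $ u" using z(3) that by simp
    also have "\<dots> = (\<Sum>v = 0..<n. M $$ (u, v) * x v)"
      using carr z(1) that by (auto simp: scalar_prod_def x_def intro!: sum.cong)
    also have "\<dots> = (\<Sum>v = 0..<n. if (u, v) \<in> ?A then x v else 0)"
      using tournament_mat_entry[OF M that] by (intro sum.cong) auto
    also have "\<dots> = (\<Sum>v\<in>{0..<n} \<inter> {v. (u, v) \<in> ?A}. x v)" by (simp add: sum.If_cases)
    also have "{0..<n} \<inter> {v. (u, v) \<in> ?A} = ?A `` {u}" using t(2) V by auto
    finally show ?thesis by simp
  qed
  define reach where "reach u = {w \<in> mat_verts M. (u, w) \<in> ?A\<^sup>*}" for u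
  have "\<exists>u<n. x u \<noteq> 0"
  proof (rule ccontr)
    assume "\<not> (\<exists>u<n. x u \<noteq> 0)"
    then have "z = 0\<^sub>v n" using z(1) by (intro eq_vecI) (auto simp: x_def)
    then show False using z(2) by simp
  qed
  \<comment> \<open>The component of such a u is terminal among those on which x does not vanish.\<close>
  then obtain u where u: "u < n" "x u \<noteq> 0"
    and least: "\<And>w. w < n \<Longrightarrow> x w \<noteq> 0 \<Longrightarrow> card (reach u) \<le> card (reach w)"
    using ex_has_least_nat[of "\<lambda>u. u < n \<and> x u \<noteq> 0" _ "\<lambda>u. card (reach u)"] by blast
  from u V obtain C where C: "C \<in> components M" "u \<in> C" using component_of[of u M] by auto
  note c = componentD[OF C(1)]
  \<comment> \<open>Such a \<open>w\<close> cannot return to \<open>u\<close>, so it reaches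
    strictly fewer vertices; the minimal choice of \<open>u\<close> rules out a nonzero value
    there.\<close>
  have zero: "x w = 0" if "(u, w) \<in> ?A\<^sup>*" "w \<notin> C" "w < n" for w
  proof (rule ccontr)
    assume "x w \<noteq> 0"
    have "(w, u) \<notin> ?A\<^sup>*"
      using that c(3)[OF C(2), of w] u V by (auto simp: mutually_reachable_def)
    then have "u \<in> reach u" "u \<notin> reach w" using u V by (auto simp: reach_def)
    moreover have "reach w \<subseteq> reach u" using that(1) by (auto simp: reach_def)
    ultimately have "reach w \<subset> reach u" by blast
    then have "card (reach w) < card (reach u)"
      using V by (intro psubset_card_mono) (auto simp: reach_def)
    then show False using least[OF that(3) \<open>x w \<noteq> 0\<close>] by simp
  qed
  have "(\<Sum>v\<in>(?A \<inter> C \<times> C) `` {w}. x v) = 0" if w: "w \<in> C" for w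
  proof -
    have wn: "w < n" using w c(1) V by auto
    have uw: "(u, w) \<in> ?A\<^sup>*" using c(3)[OF C(2)] w by (auto simp: mutually_reachable_def)
    have "(\<Sum>v\<in>(?A \<inter> C \<times> C) `` {w}. x v) = (\<Sum>v\<in>?A `` {w}. x v)"
    proof (rule sum.mono_neutral_left)
      show "finite (?A `` {w})" using t(5) by simp
      show "\<forall>v\<in>?A `` {w} - (?A \<inter> C \<times> C) `` {w}. x v = 0"
      proof
        fix v assume v: "v \<in> ?A `` {w} - (?A \<inter> C \<times> C) `` {w}"
        then have "(w, v) \<in> ?A" "v \<notin> C" using w by auto
        moreover from this have "v < n" using t(2) V by auto
        ultimately show "x v = 0" using zero uw by (meson rtrancl_into_rtrancl)
      qed
    qed auto
    then show ?thesis using row[OF wn] by simp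
  qed
  then have "x u = 0" using ker[OF C(1)] C(2) unfolding trivial_kernel_def by blast
  then show False using u(2) by simp
qed

lemma card_strong_components: "card (strong_components M) = card (components M)"
  unfolding strong_components_def by (rule card_image) (auto intro: inj_onI)

section \<open>The bound and its equality case\<close>

theorem theorem3p3:
  fixes n :: nat and M :: "real mat"
  assumes "n \<ge> 3" and "M \<in> tournament_mats n"
  shows "(M \<in> tournament_mats n - singular_tournament_mats n \<longrightarrow>
            num_3cycles M \<ge> n - 2 * (n div 3)) \<and>
         ((M \<in> tournament_mats n - singular_tournament_mats n \<and>
             num_3cycles M = n - 2 * (n div 3)) \<longleftrightarrow>
          ((\<forall>H \<in> strong_components M. upset_tournament H) \<and>
             card (strong_components M) = n div 3))"
proof -
  note M = assms(2)
  let ?K = "components M" and ?A = "\<lambda>C. mat_arcs M \<inter> C \<times> C"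
  let ?c = "\<lambda>C. card (cyclic_triples C (?A C))"
  have carr: "M \<in> carrier_mat n n" using M by (simp add: tournament_mats_def)
  have nonsing: "M \<in> tournament_mats n - singular_tournament_mats n \<longleftrightarrow> det M \<noteq> 0"
    using M invertible_mat_iff_det[OF carr] by (simp add: singular_tournament_mats_def)
  have T: "tournament (C, ?A C)" if "C \<in> ?K" for C
    using tournament_induced[OF tournament_of_mat[OF M]] componentD(1)[OF that] by blast
  have size: "(\<Sum>C\<in>?K. card C) = n" using sum_card_components[of M] carr by auto
  have cycles: "num_3cycles M = (\<Sum>C\<in>?K. ?c C)" by (rule num_3cycles_components)
  \<comment> \<open>With k components of order at least 3, the individual bounds add up to n - 2 k;
    the additive form avoids truncated subtraction.\<close>
  have excess: "(\<Sum>C\<in>?K. card C - 2) + 2 * card ?K = n" "3 * card ?K \<le> n"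
    if "\<And>C. C \<in> ?K \<Longrightarrow> card C \<ge> 3"
  proof -
    have "(\<Sum>C\<in>?K. card C - 2) + 2 * card ?K = (\<Sum>C\<in>?K. (card C - 2) + 2)"
      by (simp only: sum.distrib sum_constant of_nat_id mult.commute)
    also have "\<dots> = (\<Sum>C\<in>?K. card C)"
      by (intro sum.cong refl) (use that in fastforce)
    finally show "(\<Sum>C\<in>?K. card C - 2) + 2 * card ?K = n" using size by simp
    show "3 * card ?K \<le> n"
      using sum_mono[of ?K "\<lambda>_. 3" card] that size by simp
  qed
  have big: "card C \<ge> 3" if "det M \<noteq> 0" "C \<in> ?K" for C
    using component_card_ge_3[OF M that(2)] singleton_component_imp_det_0[OF M] that
    by (metis card_1_singletonE)
  have strong: "card C - 2 \<le> ?c C" "?c C = card C - 2 \<Longrightarrow> \<exists>p. tight_ordering C (?A C) p"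
    if "C \<in> ?K" "card C \<ge> 3" for C
    using strong_tournament_cyclic_triples[OF T[OF that(1)] that(2) component_strong[OF that(1)]]
    by blast+
  have lower: "(\<Sum>C\<in>?K. card C - 2) \<le> num_3cycles M" if "det M \<noteq> 0"
    unfolding cycles using strong(1) big[OF that] by (intro sum_mono) blast
  have bound: "n - 2 * (n div 3) \<le> num_3cycles M" if "det M \<noteq> 0"
  proof -
    have "(\<Sum>C\<in>?K. card C - 2) + 2 * card ?K = n" "3 * card ?K \<le> n"
      using excess big[OF that] by blast+
    moreover from this(2) have "card ?K \<le> n div 3" by simp
    ultimately show ?thesis using lower[OF that] by linarith
  qed
  have "(det M \<noteq> 0 \<and> num_3cycles M = n - 2 * (n div 3)) \<longleftrightarrow>
      ((\<forall>C\<in>?K. upset_tournament (C, ?A C)) \<and> card ?K = n div 3)"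
  proof
    assume eq: "det M \<noteq> 0 \<and> num_3cycles M = n - 2 * (n div 3)"
    then have det: "det M \<noteq> 0" by simp
    have ex: "(\<Sum>C\<in>?K. card C - 2) + 2 * card ?K = n" "3 * card ?K \<le> n"
      using excess big[OF det] by blast+
    have "card ?K \<le> n div 3" using ex(2) by simp
    moreover have "2 * (n div 3) \<le> n" by simp
    \<comment> \<open>Fewer than n div 3 components would push the lower bound n - 2 k above the
      assumed number of 3-cycles.\<close>
    ultimately have k: "card ?K = n div 3" using ex(1) lower[OF det] eq by linarith
    have sums: "(\<Sum>C\<in>?K. card C - 2) = (\<Sum>C\<in>?K. ?c C)"
      using ex(1) eq k cycles by linarith
    have "upset_tournament (C, ?A C)" if C: "C \<in> ?K" for C
    proof -
      \<comment> \<open>The sums agree and the terms are ordered, so equality holds in every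
        component.\<close>
      have "?c C = card C - 2"
        using sum_mono_inv[OF sums _ C finite_components] strong(1) big[OF det] by simp
      then show ?thesis
        using strong(2)[OF C big[OF det C]] tight_ordering_imp_upset[OF T[OF C]] big[OF det C] by blast
    qed
    then show "(\<forall>C\<in>?K. upset_tournament (C, ?A C)) \<and> card ?K = n div 3" using k by blast
  next
    assume up: "(\<forall>C\<in>?K. upset_tournament (C, ?A C)) \<and> card ?K = n div 3"
    have c3: "card C \<ge> 3" if "C \<in> ?K" for C
      using up that unfolding upset_tournament_def by fastforce
    have tight: "\<exists>p. tight_ordering C (?A C) p" if "C \<in> ?K" for C
      using up that upset_imp_tight_ordering by blast
    \<comment> \<open>The other n div 3 - 1 components use at least 3 vertices each, which leaves at
      most 3 + n mod 3 for \<open>C\<close>.\<close>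
    have c5: "card C \<le> 5" if C: "C \<in> ?K" for C
    proof -
      have "n = card C + (\<Sum>D\<in>?K - {C}. card D)"
        using size sum.remove[OF finite_components C, of card] by simp
      moreover have "(\<Sum>D\<in>?K - {C}. 3) \<le> (\<Sum>D\<in>?K - {C}. card D)"
        using c3 by (intro sum_mono) blast
      moreover have "card (?K - {C}) = n div 3 - 1" using up C finite_components by simp
      ultimately show ?thesis using assms(1) by simp
    qed
    have "det M \<noteq> 0"
      using tight_ordering_trivial_kernel[OF T] tight c3 c5
      by (intro trivial_kernel_components_imp_det[OF M]) blast
    moreover have "num_3cycles M = (\<Sum>C\<in>?K. card C - 2)"
      unfolding cycles using card_cyclic_triples_tight[OF T] tight c3
      by (intro sum.cong refl) blast
    ultimately show "det M \<noteq> 0 \<and> num_3cycles M = n - 2 * (n div 3)"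
      using excess(1) c3 up by (metis add_diff_cancel_right')
  qed
  then show ?thesis
    using bound nonsing card_strong_components[of M] unfolding strong_components_def by simp
qed

end
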